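(* A natural number $\alpha\in A$ is composite if and only if $\alpha\in A^{(-)}$, and a natural number $\beta\in B$ is composite if and only if $\beta\in B^{(-)}$.
   Context: $\mathbb{N}=\{1,2,3,\dots\}$. Define $A=\{6k-1:k\in\mathbb{N}\}$ and $B=\{6k+1:k\in\mathbb{N}\}$. Define $A^{(-)}\subset A$ as the set of $\alpha\in A$ of the form $\alpha=36ij-6i+6j-1$ for some $i,j\in\mathbb{N}$. Define $B^{(-)}\subset B$ as the set of $\beta\in B$ such that, for some $i,j\in\mathbb{N}$, $\beta=36ij-6i-6j+1$ or $\beta=36ij+6i+6j+1$. *)

theory Defs
  imports "HOL-Computational_Algebra.Primes"
begin

(* The positive integers are rendered as the k :: nat with k \<ge> 1.  All indices below are at
   least 1, so the subtractions on nat, read from left to right, never truncate. *)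

definition setA :: "nat set" where
  "setA = {6 * k - 1 | k. k \<ge> 1}"

definition setB :: "nat set" where
  "setB = {6 * k + 1 | k. k \<ge> 1}"

definition setA_minus :: "nat set" where
  "setA_minus = {\<alpha> \<in> setA. \<exists>i\<ge>1. \<exists>j\<ge>1. \<alpha> = 36 * i * j - 6 * i + 6 * j - 1}"

definition setB_minus :: "nat set" where
  "setB_minus = {\<beta> \<in> setB. \<exists>i\<ge>1. \<exists>j\<ge>1.
     \<beta> = 36 * i * j - 6 * i - 6 * j + 1 \<or> \<beta> = 36 * i * j + 6 * i + 6 * j + 1}"

definition composite :: "nat \<Rightarrow> bool" where
  "composite n \<longleftrightarrow> n > 1 \<and> \<not> prime n"

end

theory Submission
  imports Defs
begin

text \<open>
  Each of the three quadratic forms factors over the integers: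
  \<open>36ij - 6i + 6j - 1 = (6i + 1)(6j - 1)\<close>,
  \<open>36ij - 6i - 6j + 1 = (6i - 1)(6j - 1)\<close> and
  \<open>36ij + 6i + 6j + 1 = (6i + 1)(6j + 1)\<close>.
  Hence \<open>setA_minus\<close> consists of the products of an element of \<open>setB\<close> and one of \<open>setA\<close>, and
  \<open>setB_minus\<close> of the products of two elements of \<open>setA\<close> or two elements of \<open>setB\<close>.

  The sets \<open>setA\<close> and \<open>setB\<close> are the residue classes \<open>5\<close> and \<open>1\<close> modulo \<open>6\<close> with the number \<open>1\<close>
  left out, so all these products have two nontrivial factors and are composite.
  Conversely, a composite number has a factorization \<open>a b\<close> with \<open>a, b > 1\<close>.  If its residue modulo
  \<open>6\<close> is the unit \<open>5\<close> or \<open>1\<close>, then \<open>a\<close> and \<open>b\<close> have unit residues too.  These residues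
  are \<open>\<plusminus>1\<close>, of opposite sign when the product is \<open>5\<close> and of equal sign when it is \<open>1\<close>.
\<close>

lemma setA_iff_mod: "n \<in> setA \<longleftrightarrow> n mod 6 = 5"
proof
  assume "n \<in> setA"
  then obtain k where "k \<ge> 1" "n = 6 * k - 1" by (auto simp: setA_def)
  then have "n = 5 + 6 * (k - 1)" by simp
  then show "n mod 6 = 5" by (simp only: mod_mult_self2) simp
next
  assume "n mod 6 = 5"
  then have "n = 6 * (n div 6) + 5" using mult_div_mod_eq[of 6 n] by simp
  then have "n = 6 * (n div 6 + 1) - 1" by simp
  moreover have "n div 6 + 1 \<ge> 1" by simp
  ultimately show "n \<in> setA" unfolding setA_def by blast
qed

lemma setB_iff_mod: "n \<in> setB \<longleftrightarrow> n mod 6 = 1 \<and> n > 1"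
proof
  assume "n \<in> setB"
  then obtain k where "k \<ge> 1" and n: "n = 1 + 6 * k" by (auto simp: setB_def)
  have "n mod 6 = 1" by (simp only: n mod_mult_self2) simp
  with \<open>k \<ge> 1\<close> n show "n mod 6 = 1 \<and> n > 1" by simp
next
  assume n: "n mod 6 = 1 \<and> n > 1"
  then have "n = 6 * (n div 6) + 1" using mult_div_mod_eq[of 6 n] by simp
  moreover from this n have "n div 6 \<ge> 1" by linarith
  ultimately show "n \<in> setB" unfolding setB_def by blast
qed

lemma composite_iff_product: "composite n \<longleftrightarrow> (\<exists>a>1. \<exists>b>1. n = a * b)"
proof
  assume "composite n"
  then have "n > 1" "\<not> prime n" by (auto simp: composite_def)
  then obtain a where a: "a dvd n" "a \<noteq> 1" "a \<noteq> n" by (auto simp: prime_nat_iff)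
  then obtain b where "n = a * b" by blast
  with a \<open>n > 1\<close> have "a > 1" "b > 1" by (auto simp: nat_neq_iff)
  with \<open>n = a * b\<close> show "\<exists>a>1. \<exists>b>1. n = a * b" by blast
next
  assume "\<exists>a>1. \<exists>b>1. n = a * b"
  then obtain a b where "a > 1" "b > 1" "n = a * b" by blast
  then show "composite n"
    using less_1_mult[of a b] by (auto simp: composite_def dest: prime_product)
qed

text \<open>
  The factorizations survive truncated subtraction because the term \<open>36ij\<close> dominates both \<open>6i\<close> and
  \<open>6j\<close> for positive indices.  With the indices written as successors, expanding the left-hand side
  cancels each subtracted term against a visible summand.
\<close>

lemma form_A_factors:
  fixes i j :: nat
  assumes "i \<ge> 1" "j \<ge> 1"
  shows "36 * i * j - 6 * i + 6 * j - 1 = (6 * i + 1) * (6 * j - 1)"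
proof -
  from assms obtain i' j' where "i = Suc i'" "j = Suc j'" by (cases i; cases j) auto
  then show ?thesis by (simp add: algebra_simps)
qed

lemma form_B_minus_factors:
  fixes i j :: nat
  assumes "i \<ge> 1" "j \<ge> 1"
  shows "36 * i * j - 6 * i - 6 * j + 1 = (6 * i - 1) * (6 * j - 1)"
proof -
  from assms obtain i' j' where "i = Suc i'" "j = Suc j'" by (cases i; cases j) auto
  then show ?thesis by (simp add: algebra_simps)
qed

lemma form_B_plus_factors:
  fixes i j :: nat
  shows "36 * i * j + 6 * i + 6 * j + 1 = (6 * i + 1) * (6 * j + 1)"
  by (simp add: algebra_simps)

lemma setA_minus_iff_product:
  "n \<in> setA_minus \<longleftrightarrow> n \<in> setA \<and> (\<exists>b\<in>setB. \<exists>a\<in>setA. n = b * a)"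
proof -
  have "(\<exists>i\<ge>1. \<exists>j\<ge>1. n = 36 * i * j - 6 * i + 6 * j - 1) \<longleftrightarrow>
        (\<exists>i\<ge>1. \<exists>j\<ge>1. n = (6 * i + 1) * (6 * j - 1))"
    by (intro ex_cong1 conj_cong refl) (simp only: form_A_factors)
  also have "\<dots> \<longleftrightarrow> (\<exists>b\<in>setB. \<exists>a\<in>setA. n = b * a)"
    unfolding setA_def setB_def by blast
  finally show ?thesis by (simp add: setA_minus_def)
qed

lemma setB_minus_iff_product:
  "n \<in> setB_minus \<longleftrightarrow> n \<in> setB \<and>
     ((\<exists>a\<in>setA. \<exists>b\<in>setA. n = a * b) \<or> (\<exists>a\<in>setB. \<exists>b\<in>setB. n = a * b))"
proof -
  have "(\<exists>i\<ge>1. \<exists>j\<ge>1. n = 36 * i * j - 6 * i - 6 * j + 1 \<or> n = 36 * i * j + 6 * i + 6 * j + 1) \<longleftrightarrow>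
        (\<exists>i\<ge>1. \<exists>j\<ge>1. n = (6 * i - 1) * (6 * j - 1) \<or> n = (6 * i + 1) * (6 * j + 1))"
    by (intro ex_cong1 conj_cong refl) (simp only: form_B_minus_factors form_B_plus_factors)
  also have "\<dots> \<longleftrightarrow> (\<exists>a\<in>setA. \<exists>b\<in>setA. n = a * b) \<or> (\<exists>a\<in>setB. \<exists>b\<in>setB. n = a * b)"
    unfolding setA_def setB_def by blast
  finally show ?thesis by (simp add: setB_minus_def)
qed

text \<open>
  The group of units modulo \<open>6\<close> is \<open>{1, 5}\<close> with \<open>5 \<cdot> 5 = 1\<close>, and a product is a unit only if
  both factors are.  This is a finite check over the \<open>36\<close> pairs of residues.
\<close>

lemma mod_6_product_cases:
  fixes a b :: nat
  shows "a * b mod 6 = 5 \<longleftrightarrow> a mod 6 = 1 \<and> b mod 6 = 5 \<or> a mod 6 = 5 \<and> b mod 6 = 1"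
    and "a * b mod 6 = 1 \<longleftrightarrow> a mod 6 = 5 \<and> b mod 6 = 5 \<or> a mod 6 = 1 \<and> b mod 6 = 1"
proof -
  have residue: "m mod 6 \<in> {0, 1, 2, 3, 4, 5}" for m :: nat
  proof -
    have "m mod 6 \<in> {..<6}" by simp
    also have "{..<6::nat} = {0, 1, 2, 3, 4, 5}" by (auto simp: numeral_eq_Suc less_Suc_eq)
    finally show ?thesis .
  qed
  have table: "\<forall>r \<in> {0, 1, 2, 3, 4, 5 :: nat}. \<forall>s \<in> {0, 1, 2, 3, 4, 5 :: nat}.
      (r * s mod 6 = 5 \<longleftrightarrow> r = 1 \<and> s = 5 \<or> r = 5 \<and> s = 1) \<and>
      (r * s mod 6 = 1 \<longleftrightarrow> r = 5 \<and> s = 5 \<or> r = 1 \<and> s = 1)"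
    by simp
  note table[rule_format, OF residue residue, of a b, unfolded mod_mult_eq]
  then show "a * b mod 6 = 5 \<longleftrightarrow> a mod 6 = 1 \<and> b mod 6 = 5 \<or> a mod 6 = 5 \<and> b mod 6 = 1"
    and "a * b mod 6 = 1 \<longleftrightarrow> a mod 6 = 5 \<and> b mod 6 = 5 \<or> a mod 6 = 1 \<and> b mod 6 = 1"
    by (rule conjunct1, rule conjunct2)
qed

lemma setA_gt_1: "n \<in> setA \<Longrightarrow> n > 1"
  by (auto simp: setA_def)

lemma setB_gt_1: "n \<in> setB \<Longrightarrow> n > 1"
  by (auto simp: setB_def)

lemma composite_setA_iff:
  assumes "n \<in> setA"
  shows "composite n \<longleftrightarrow> n \<in> setA_minus"
proof
  assume "composite n"
  then obtain a b where ab: "a > 1" "b > 1" "n = a * b"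
    unfolding composite_iff_product by blast
  with assms have "a mod 6 = 1 \<and> b mod 6 = 5 \<or> a mod 6 = 5 \<and> b mod 6 = 1"
    by (simp add: setA_iff_mod mod_6_product_cases)
  with ab have "a \<in> setB \<and> b \<in> setA \<or> b \<in> setB \<and> a \<in> setA"
    by (auto simp: setA_iff_mod setB_iff_mod)
  with ab assms show "n \<in> setA_minus"
    unfolding setA_minus_iff_product by (metis mult.commute)
next
  assume "n \<in> setA_minus"
  then show "composite n"
    unfolding setA_minus_iff_product composite_iff_product
    using setA_gt_1 setB_gt_1 by blast
qed

lemma composite_setB_iff:
  assumes "n \<in> setB"
  shows "composite n \<longleftrightarrow> n \<in> setB_minus"
proof
  assume "composite n"
  then obtain a b where ab: "a > 1" "b > 1" "n = a * b"
    unfolding composite_iff_product by blast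
  with assms have "a mod 6 = 5 \<and> b mod 6 = 5 \<or> a mod 6 = 1 \<and> b mod 6 = 1"
    by (simp only: setB_iff_mod mod_6_product_cases)
  with ab have "a \<in> setA \<and> b \<in> setA \<or> a \<in> setB \<and> b \<in> setB"
    by (auto simp: setA_iff_mod setB_iff_mod)
  with ab assms show "n \<in> setB_minus"
    unfolding setB_minus_iff_product by blast
next
  assume "n \<in> setB_minus"
  then show "composite n"
    unfolding setB_minus_iff_product composite_iff_product
    using setA_gt_1 setB_gt_1 by blast
qed

theorem theorem2:
  shows "(\<forall>\<alpha>\<in>setA. composite \<alpha> \<longleftrightarrow> \<alpha> \<in> setA_minus) \<and>
         (\<forall>\<beta>\<in>setB. composite \<beta> \<longleftrightarrow> \<beta> \<in> setB_minus)"
  using composite_setA_iff composite_setB_iff by blast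

end
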